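(* Let $n\geq 1$ be an integer and let $\alpha$ be an irrational real number with $\alpha>\frac{3+\sqrt{5}}{2}$. Let $f_\alpha:\mathbb{N}\to\mathbb{N}$ be given by $f_\alpha(x)=\lfloor \alpha x\rfloor$, and let $f_\alpha^n$ be its $n$-fold iterate. Then a natural number $x\in\mathbb{N}$ belongs to the range of $f_\alpha^n$ if and only if $$1-\frac{1}{\alpha}<\left\{\frac{x}{\alpha}\right\}<1$$ and, for each $i=2,\ldots,n$, $$1-\frac{2}{\alpha}<\left\{\frac{x}{\alpha^{i}}\right\}-\frac{\left\{\frac{x}{\alpha^{i-1}}\right\}}{\alpha}<1-\frac{1}{\alpha}.$$
   Context: $\mathbb{N}=\{1,2,3,\ldots\}$ denotes the set of positive integers. For a real number $\beta$, $\lfloor\beta\rfloor$ is its integer part (floor) and $\{\beta\}=\beta-\lfloor\beta\rfloor$ is its fractional part. The $n$-fold iterate is $f_\alpha^n=f_\alpha\circ\cdots\circ f_\alpha$ ($n$ times), with domain $\mathbb{N}$. When $n=1$ the condition for $i=2,\ldots,n$ is vacuous. *)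

theory Defs
  imports Complex_Main
begin

text \<open>
  The positive integers are represented by the set \<open>{1..}\<close> of type \<open>nat set\<close>.
  For \<open>\<alpha> \<ge> 1\<close> the floor below is positive whenever \<open>x\<close> is, so \<open>nat\<close> loses nothing
  and the function maps \<open>{1..}\<close> into itself.
\<close>

definition floor_mult :: "real \<Rightarrow> nat \<Rightarrow> nat" where
  "floor_mult \<alpha> x = nat \<lfloor>\<alpha> * real x\<rfloor>"

end

theory Submission
  imports Defs
begin

text \<open>
  For irrational \<open>\<alpha> > 1\<close> the equation \<open>\<lfloor>\<alpha> z\<rfloor> = y\<close> with \<open>z \<ge> 1\<close> says exactly that \<open>z\<close> exceeds
  \<open>y / \<alpha>\<close> by an amount in the open interval \<open>(0, 1/\<alpha>)\<close> (lemma \<open>floor_mult_eq_iff\<close>). Along a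
  backward orbit \<open>x = x\<^sub>0, x\<^sub>1, \<dots>, x\<^sub>n\<close> these errors accumulate geometrically, so that \<open>x\<^sub>i\<close> exceeds
  \<open>x / \<alpha>\<^sup>i\<close> by less than \<open>1/\<alpha> + 1/\<alpha>\<^sup>2 + \<dots> = 1/(\<alpha> - 1)\<close>. For \<open>\<alpha> > 2\<close> this is less than 1, which
  forces \<open>x\<^sub>i = \<lfloor>x / \<alpha>\<^sup>i\<rfloor> + 1\<close>: the only possible \<open>i\<close>-th ancestor of \<open>x\<close> is known in advance
  (lemmas \<open>funpow_floor_mult_error\<close> and \<open>ancestor_eq\<close>).

  Hence \<open>x\<close> lies in the range of the \<open>n\<close>-th iterate iff each of these candidates is mapped to the
  preceding one (lemma \<open>in_range_funpow_iff\<close>). By the first observation this is a condition on the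
  differences \<open>x\<^sub>i - x\<^sub>i\<^sub>-\<^sub>1 / \<alpha>\<close>; writing \<open>\<lfloor>t\<rfloor> = t - frac t\<close> the terms \<open>x / \<alpha>\<^sup>i\<close> cancel, and what
  remains are the inequalities between consecutive fractional parts. The first of them looks
  different because \<open>x\<^sub>0 = x\<close> itself, rather than \<open>\<lfloor>x\<rfloor> + 1\<close>.
\<close>

text \<open>
  Irrationality makes the left inequality strict: \<open>\<alpha> z\<close> is never an integer when \<open>z \<ge> 1\<close>.
\<close>

lemma floor_mult_eq_iff:
  fixes \<alpha> :: real and y z :: nat
  assumes "\<alpha> \<notin> \<rat>" and "\<alpha> > 0" and "z \<ge> 1"
  shows "floor_mult \<alpha> z = y \<longleftrightarrow> 0 < real z - real y / \<alpha> \<and> real z - real y / \<alpha> < 1 / \<alpha>"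
proof -
  have "\<alpha> * real z \<noteq> real y"
  proof
    assume "\<alpha> * real z = real y"
    then have "\<alpha> = real y / real z"
      using assms(3) by (simp add: field_simps)
    then show False
      using assms(1) by auto
  qed
  moreover have "floor_mult \<alpha> z = y \<longleftrightarrow> \<lfloor>\<alpha> * real z\<rfloor> = int y"
    using assms(2) by (auto simp: floor_mult_def)
  ultimately have "floor_mult \<alpha> z = y \<longleftrightarrow> real y < \<alpha> * real z \<and> \<alpha> * real z < real y + 1"
    by (auto simp: floor_eq_iff)
  moreover have "real z - real y / \<alpha> = (\<alpha> * real z - real y) / \<alpha>"
    using assms(2) by (simp add: field_simps)
  ultimately show ?thesis
    using assms(2) by (auto simp: divide_less_cancel zero_less_divide_iff)
qed

lemma floor_mult_pos:
  assumes "\<alpha> \<ge> 1" and "z \<ge> 1"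
  shows "floor_mult \<alpha> z \<ge> 1"
proof -
  have "1 * 1 \<le> \<alpha> * real z"
    using assms by (intro mult_mono) auto
  then show ?thesis
    by (simp add: floor_mult_def le_nat_iff le_floor_iff)
qed

lemma funpow_floor_mult_pos:
  assumes "\<alpha> \<ge> 1" and "z \<ge> 1"
  shows "(floor_mult \<alpha> ^^ n) z \<ge> 1"
  by (induction n) (use assms floor_mult_pos in auto)

text \<open>
  The bound \<open>1/(\<alpha> - 1)\<close> is the fixed point of \<open>e \<mapsto> (e + 1) / \<alpha>\<close>, the worst growth of the error in
  one backward step, so it is preserved by the induction.
\<close>

lemma funpow_floor_mult_error:
  fixes \<alpha> :: real and z :: nat
  assumes "\<alpha> \<notin> \<rat>" and "\<alpha> > 1" and "z \<ge> 1"
  shows "0 \<le> real z - real ((floor_mult \<alpha> ^^ n) z) / \<alpha> ^ n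
       \<and> real z - real ((floor_mult \<alpha> ^^ n) z) / \<alpha> ^ n < 1 / (\<alpha> - 1)
       \<and> (n > 0 \<longrightarrow> 0 < real z - real ((floor_mult \<alpha> ^^ n) z) / \<alpha> ^ n)"
  using assms(3)
proof (induction n arbitrary: z)
  case 0
  then show ?case using assms by simp
next
  case (Suc n)
  define w where "w = floor_mult \<alpha> z"
  define x where "x = (floor_mult \<alpha> ^^ n) w"
  have x: "(floor_mult \<alpha> ^^ Suc n) z = x"
    by (simp add: x_def w_def funpow_Suc_right del: funpow.simps)
  have "w \<ge> 1"
    using floor_mult_pos[of \<alpha> z] assms(2) Suc.prems by (simp add: w_def)
  from Suc.IH[OF this]
  have lo: "0 \<le> real w - real x / \<alpha> ^ n" and hi: "real w - real x / \<alpha> ^ n < 1 / (\<alpha> - 1)"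
    by (simp_all add: x_def)
  have step: "0 < real z - real w / \<alpha>" "real z - real w / \<alpha> < 1 / \<alpha>"
    using floor_mult_eq_iff[of \<alpha> z w] assms Suc.prems by (auto simp: w_def)
  have split: "real z - real x / \<alpha> ^ Suc n
      = (real z - real w / \<alpha>) + (real w - real x / \<alpha> ^ n) / \<alpha>"
    using assms(2) by (simp add: field_simps)
  have "0 \<le> (real w - real x / \<alpha> ^ n) / \<alpha>"
    using lo assms(2) by simp
  moreover have "(real w - real x / \<alpha> ^ n) / \<alpha> < (1 / (\<alpha> - 1)) / \<alpha>"
    using hi assms(2) by (intro divide_strict_right_mono) auto
  moreover have "1 / \<alpha> + (1 / (\<alpha> - 1)) / \<alpha> = 1 / (\<alpha> - 1)"
    using assms(2) by (simp add: divide_simps)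
  ultimately show ?case
    unfolding x split using step by linarith
qed

definition ancestor :: "real \<Rightarrow> nat \<Rightarrow> nat \<Rightarrow> nat" where
  "ancestor \<alpha> x i = (if i = 0 then x else nat \<lfloor>real x / \<alpha> ^ i\<rfloor> + 1)"

lemma ancestor_0 [simp]: "ancestor \<alpha> x 0 = x"
  by (simp add: ancestor_def)

lemma ancestor_pos: "x \<ge> 1 \<Longrightarrow> ancestor \<alpha> x i \<ge> 1"
  by (simp add: ancestor_def)

lemma real_ancestor:
  assumes "\<alpha> > 0" and "i > 0"
  shows "real (ancestor \<alpha> x i) = real x / \<alpha> ^ i - frac (real x / \<alpha> ^ i) + 1"
  using assms by (simp add: ancestor_def frac_def)

lemma ancestor_eq:
  fixes \<alpha> :: real and z :: nat
  assumes "\<alpha> \<notin> \<rat>" and "\<alpha> > 2" and "z \<ge> 1" and "(floor_mult \<alpha> ^^ i) z = x"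
  shows "ancestor \<alpha> x i = z"
proof (cases "i = 0")
  case True
  then show ?thesis using assms(4) by simp
next
  case False
  have "1 / (\<alpha> - 1) < 1"
    using assms(2) by simp
  moreover have "0 < real z - real x / \<alpha> ^ i" "real z - real x / \<alpha> ^ i < 1 / (\<alpha> - 1)"
    using funpow_floor_mult_error[of \<alpha> z i] assms False by auto
  ultimately have "real x / \<alpha> ^ i < real z" "real z < real x / \<alpha> ^ i + 1"
    by linarith+
  then have "\<lfloor>real x / \<alpha> ^ i\<rfloor> = int z - 1"
    by (simp add: floor_eq_iff)
  then show ?thesis
    using False assms(3) by (simp add: ancestor_def)
qed

lemma in_range_funpow_iff:
  fixes \<alpha> :: real and x :: nat
  assumes "\<alpha> \<notin> \<rat>" and "\<alpha> > 2" and "x \<ge> 1"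
  shows "x \<in> (floor_mult \<alpha> ^^ n) ` {1..} \<longleftrightarrow>
    (\<forall>i\<in>{1..n}. floor_mult \<alpha> (ancestor \<alpha> x i) = ancestor \<alpha> x (i - 1))"
proof
  assume "x \<in> (floor_mult \<alpha> ^^ n) ` {1..}"
  then obtain z where z: "z \<ge> 1" "(floor_mult \<alpha> ^^ n) z = x"
    by auto
  have anc: "ancestor \<alpha> x i = (floor_mult \<alpha> ^^ (n - i)) z" if "i \<le> n" for i
  proof (rule ancestor_eq)
    show "(floor_mult \<alpha> ^^ (n - i)) z \<ge> 1"
      using funpow_floor_mult_pos assms(2) z(1) by simp
    have "(floor_mult \<alpha> ^^ i) ((floor_mult \<alpha> ^^ (n - i)) z) = (floor_mult \<alpha> ^^ (i + (n - i))) z"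
      by (simp only: funpow_add o_apply)
    then show "(floor_mult \<alpha> ^^ i) ((floor_mult \<alpha> ^^ (n - i)) z) = x"
      using z(2) that by simp
  qed (use assms in auto)
  show "\<forall>i\<in>{1..n}. floor_mult \<alpha> (ancestor \<alpha> x i) = ancestor \<alpha> x (i - 1)"
  proof
    fix i assume i: "i \<in> {1..n}"
    then have "n - (i - 1) = Suc (n - i)"
      by auto
    then show "floor_mult \<alpha> (ancestor \<alpha> x i) = ancestor \<alpha> x (i - 1)"
      using i anc[of i] anc[of "i - 1"] by simp
  qed
next
  assume *: "\<forall>i\<in>{1..n}. floor_mult \<alpha> (ancestor \<alpha> x i) = ancestor \<alpha> x (i - 1)"
  have "(floor_mult \<alpha> ^^ i) (ancestor \<alpha> x i) = x" if "i \<le> n" for i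
    using that
  proof (induction i)
    case (Suc i)
    then have "floor_mult \<alpha> (ancestor \<alpha> x (Suc i)) = ancestor \<alpha> x i"
      using * by force
    then show ?case
      using Suc by (simp add: funpow_Suc_right del: funpow.simps)
  qed simp
  from this[of n] have "x = (floor_mult \<alpha> ^^ n) (ancestor \<alpha> x n)"
    by simp
  then show "x \<in> (floor_mult \<alpha> ^^ n) ` {1..}"
    using ancestor_pos[OF assms(3)] by (intro image_eqI) auto
qed

theorem mainTheorem1:
  fixes n x :: nat and \<alpha> :: real
  assumes "n \<ge> 1"
    and "\<alpha> \<notin> \<rat>"
    and "\<alpha> > (3 + sqrt 5) / 2"
    and "x \<ge> 1"
  shows "x \<in> (floor_mult \<alpha> ^^ n) ` {1..} \<longleftrightarrow>
    (1 - 1 / \<alpha> < frac (real x / \<alpha>) \<and> frac (real x / \<alpha>) < 1) \<and>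
    (\<forall>i\<in>{2..n}.
       1 - 2 / \<alpha> < frac (real x / \<alpha> ^ i) - frac (real x / \<alpha> ^ (i - 1)) / \<alpha> \<and>
       frac (real x / \<alpha> ^ i) - frac (real x / \<alpha> ^ (i - 1)) / \<alpha> < 1 - 1 / \<alpha>)"
proof -
  have "2 < (3 + sqrt 5) / 2"
    by (simp add: field_simps)
  then have \<alpha>: "\<alpha> > 2"
    using assms(3) by (rule less_trans)
  have step: "floor_mult \<alpha> (ancestor \<alpha> x i) = ancestor \<alpha> x (i - 1) \<longleftrightarrow>
      0 < real (ancestor \<alpha> x i) - real (ancestor \<alpha> x (i - 1)) / \<alpha> \<and>
      real (ancestor \<alpha> x i) - real (ancestor \<alpha> x (i - 1)) / \<alpha> < 1 / \<alpha>" for i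
    using assms(2,4) \<alpha> by (intro floor_mult_eq_iff ancestor_pos) auto
  have first: "floor_mult \<alpha> (ancestor \<alpha> x 1) = ancestor \<alpha> x (1 - 1) \<longleftrightarrow>
      1 - 1 / \<alpha> < frac (real x / \<alpha>) \<and> frac (real x / \<alpha>) < 1"
  proof -
    have "real (ancestor \<alpha> x 1) - real (ancestor \<alpha> x (1 - 1)) / \<alpha> = 1 - frac (real x / \<alpha>)"
      using real_ancestor[of \<alpha> 1 x] \<alpha> by simp
    then show ?thesis
      unfolding step by linarith
  qed
  have later: "floor_mult \<alpha> (ancestor \<alpha> x i) = ancestor \<alpha> x (i - 1) \<longleftrightarrow>
      1 - 2 / \<alpha> < frac (real x / \<alpha> ^ i) - frac (real x / \<alpha> ^ (i - 1)) / \<alpha> \<and>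
      frac (real x / \<alpha> ^ i) - frac (real x / \<alpha> ^ (i - 1)) / \<alpha> < 1 - 1 / \<alpha>"
    if "i \<in> {2..n}" for i
  proof -
    have "real x / \<alpha> ^ (i - 1) / \<alpha> = real x / \<alpha> ^ i"
      using that power_minus_mult[of i \<alpha>] by simp
    moreover have "real (ancestor \<alpha> x (i - 1))
        = real x / \<alpha> ^ (i - 1) - frac (real x / \<alpha> ^ (i - 1)) + 1"
      using that \<alpha> by (intro real_ancestor) auto
    ultimately have "real (ancestor \<alpha> x (i - 1)) / \<alpha>
        = real x / \<alpha> ^ i - frac (real x / \<alpha> ^ (i - 1)) / \<alpha> + 1 / \<alpha>"
      by (simp only: add_divide_distrib diff_divide_distrib)
    moreover have "real (ancestor \<alpha> x i) = real x / \<alpha> ^ i - frac (real x / \<alpha> ^ i) + 1"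
      using that \<alpha> by (intro real_ancestor) auto
    moreover have "2 / \<alpha> = 1 / \<alpha> + 1 / \<alpha>"
      by simp
    ultimately show ?thesis
      unfolding step by linarith
  qed
  have "{1..n} = insert 1 {2..n}"
    using assms(1) by auto
  then show ?thesis
    using in_range_funpow_iff[OF assms(2) \<alpha> assms(4), of n] first later by simp
qed

end
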